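(* Let $G$ be a graph with $n \ge 1$ vertices and let $\overline{G}$ be its complement. Then \[ n - 1 \le \sqrt{s^{+}(G)} + \sqrt{s^{+}(\overline{G})} < \sqrt{2}\, n . \]
   Context: All graphs are finite, simple and undirected. For a graph $G$ on $n$ vertices with adjacency matrix $A$, let $\mu_1(G) \ge \dots \ge \mu_n(G)$ be the eigenvalues of $A$ counted with multiplicity. Define $s^{+}(G) = \sum_{i:\, \mu_i(G) > 0} \mu_i(G)^2$, the sum of the squares of the positive eigenvalues of $A$ (an empty sum is $0$). $\overline{G}$ denotes the complement of $G$. *)

theory Defs
  imports
    "Graph_Theory.Pair_Digraph"
    "Jordan_Normal_Form.Char_Poly"
begin

(* A finite simple undirected graph is a pair_graph: each edge {u,v} is represented by the two
   arcs (u,v) and (v,u). *)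

definition graph_complement :: "'a pair_pre_digraph \<Rightarrow> 'a pair_pre_digraph" where
  "graph_complement G =
     \<lparr> pverts = pverts G,
       parcs = {(u, v). u \<in> pverts G \<and> v \<in> pverts G \<and> u \<noteq> v \<and> (u, v) \<notin> parcs G} \<rparr>"

lemma pair_graph_complement:
  assumes "pair_graph G"
  shows "pair_graph (graph_complement G)"
proof -
  interpret pair_graph G by fact
  have "finite (parcs (graph_complement G))"
    by (rule finite_subset[of _ "pverts G \<times> pverts G"])
       (auto simp: graph_complement_def pair_finite_verts)
  moreover have "symmetric (with_proj (graph_complement G))"
    using pair_sym_arcs
    by (auto simp: graph_complement_def symmetric_def arcs_ends_conv intro!: symI dest: symD)
  ultimately show ?thesis
    by unfold_locales (auto simp: graph_complement_def pair_finite_verts)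
qed

(* The matrix type is indexed by natural numbers, so the vertices have to be enumerated.  Another
   enumeration conjugates the matrix by a permutation matrix and gives the same eigenvalues. *)

definition vertex_list :: "'a pair_pre_digraph \<Rightarrow> 'a list" where
  "vertex_list G = (SOME vs. distinct vs \<and> set vs = pverts G)"

lemma vertex_list:
  assumes "finite (pverts G)"
  shows "distinct (vertex_list G)" and "set (vertex_list G) = pverts G"
    and "length (vertex_list G) = card (pverts G)"
proof -
  have "\<exists>vs. distinct vs \<and> set vs = pverts G"
    using finite_distinct_list[OF assms] by blast
  from someI_ex[OF this]
  show "distinct (vertex_list G)" "set (vertex_list G) = pverts G"
    unfolding vertex_list_def by auto
  then show "length (vertex_list G) = card (pverts G)"
    by (metis distinct_card)
qed

definition adjacency_matrix :: "'a pair_pre_digraph \<Rightarrow> real mat" where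
  "adjacency_matrix G =
     mat (card (pverts G)) (card (pverts G))
       (\<lambda>(i, j). if (vertex_list G ! i, vertex_list G ! j) \<in> parcs G then 1 else 0)"

(* The eigenvalues with multiplicity.  The roots are taken over the reals; this misses none, since
   the adjacency matrix of a graph is real symmetric. *)

definition graph_eigenvalues :: "'a pair_pre_digraph \<Rightarrow> real multiset" where
  "graph_eigenvalues G = proots (char_poly (adjacency_matrix G))"

definition s_plus :: "'a pair_pre_digraph \<Rightarrow> real" where
  "s_plus G = (\<Sum>\<mu> \<in># filter_mset (\<lambda>\<mu>. \<mu> > 0) (graph_eigenvalues G). \<mu>\<^sup>2)"

end

theory Submission
  imports Defs
    "Jordan_Normal_Form.Jordan_Normal_Form_Uniqueness"
    "Jordan_Normal_Form.Schur_Decomposition"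
    "HOL-Analysis.L2_Norm"
begin

text \<open>For a graph with \<open>m\<close> edges, \<open>s\<^sup>+\<close> is at most the sum \<open>2 m\<close> of the squares of all eigenvalues
  (the trace of the squared adjacency matrix) and at least the square of the largest eigenvalue,
  which is at least the average degree \<open>2 m / n\<close> (the Rayleigh quotient of the all-ones vector).
  A graph and its complement together have \<open>n (n - 1) / 2\<close> edges, so the lower bound follows by
  adding and the upper bound from \<open>(a + b)\<^sup>2 \<le> 2 (a\<^sup>2 + b\<^sup>2)\<close>.\<close>

section \<open>Traces, similarity and triangular matrices\<close>

definition mat_trace :: "'a :: comm_monoid_add mat \<Rightarrow> 'a" where
  "mat_trace A = (\<Sum>i<dim_row A. A $$ (i, i))"

lemma index_mult_mat_sum:
  assumes "A \<in> carrier_mat n m" "B \<in> carrier_mat m k" "i < n" "j < k"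
  shows "(A * B) $$ (i, j) = (\<Sum>l<m. A $$ (i, l) * B $$ (l, j))"
  using assms by (auto simp: scalar_prod_def atLeast0LessThan)

lemma mat_trace_mult_commute:
  fixes A B :: "'a :: comm_semiring_1 mat"
  assumes A: "A \<in> carrier_mat n m" and B: "B \<in> carrier_mat m n"
  shows "mat_trace (A * B) = mat_trace (B * A)"
proof -
  have "mat_trace (A * B) = (\<Sum>i<n. \<Sum>l<m. A $$ (i, l) * B $$ (l, i))"
    using A unfolding mat_trace_def by (auto simp: index_mult_mat_sum[OF A B] simp del: index_mult_mat(1))
  also have "\<dots> = (\<Sum>l<m. \<Sum>i<n. B $$ (l, i) * A $$ (i, l))"
    by (subst sum.swap) (simp add: mult.commute)
  also have "\<dots> = mat_trace (B * A)"
    using B unfolding mat_trace_def by (auto simp: index_mult_mat_sum[OF B A] simp del: index_mult_mat(1))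
  finally show ?thesis .
qed

text \<open>Cyclicity of the trace moves \<open>Q\<close> in front of \<open>P * B\<close>, where it
  cancels \<open>P\<close>.\<close>

lemma mat_trace_similar:
  fixes A B :: "'a :: comm_semiring_1 mat"
  assumes "similar_mat A B"
  shows "mat_trace A = mat_trace B"
proof -
  obtain n P Q where *: "A \<in> carrier_mat n n" "B \<in> carrier_mat n n" "P \<in> carrier_mat n n"
      "Q \<in> carrier_mat n n" "Q * P = 1\<^sub>m n" "A = P * B * Q"
    using similar_matD[OF assms] by auto
  have "mat_trace A = mat_trace (Q * (P * B))"
    unfolding *(6) by (rule mat_trace_mult_commute) (use * in auto)
  also have "Q * (P * B) = B"
    using * by (metis assoc_mult_mat left_mult_one_mat)
  finally show ?thesis .
qed

text \<open>A nonzero product \<open>B $$ (i, l) * B $$ (l, j)\<close> requires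
  \<open>i \<le> l \<le> j\<close>. Below the diagonal no such \<open>l\<close> exists, and on it
  only \<open>l = i\<close> remains.\<close>

lemma upper_triangular_square:
  fixes B :: "'a :: comm_ring_1 mat"
  assumes B: "B \<in> carrier_mat n n" and ut: "upper_triangular B"
  shows "upper_triangular (B * B)" and "i < n \<Longrightarrow> (B * B) $$ (i, i) = (B $$ (i, i))\<^sup>2"
proof -
  have zero: "B $$ (i, l) * B $$ (l, j) = 0" if "i < n" "l < n" "j \<le> i" "l \<noteq> i \<or> j < i" for i j l
    using ut B that unfolding upper_triangular_def
    by (metis carrier_matD(1) linorder_neqE_nat mult_eq_0_iff mult_zero_left mult_zero_right order_le_less_trans order_less_le_trans)
  show "upper_triangular (B * B)"
    unfolding upper_triangular_def
  proof (intro allI impI)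
    fix i j assume "i < dim_row (B * B)" "j < i"
    hence "i < n" "j < n" "j < i" using B by auto
    thus "(B * B) $$ (i, j) = 0"
      unfolding index_mult_mat_sum[OF B B \<open>i < n\<close> \<open>j < n\<close>]
      by (intro sum.neutral ballI zero) auto
  qed
  assume i: "i < n"
  have "(B * B) $$ (i, i) = (\<Sum>l<n. if l = i then (B $$ (i, i))\<^sup>2 else 0)"
    unfolding index_mult_mat_sum[OF B B i i]
    by (intro sum.cong refl) (use zero i in \<open>auto simp: power2_eq_square\<close>)
  thus "(B * B) $$ (i, i) = (B $$ (i, i))\<^sup>2" using i by simp
qed

lemma similar_mat_square:
  assumes "similar_mat A (B :: 'a :: semiring_1 mat)"
  shows "similar_mat (A * A) (B * B)"
proof -
  obtain P Q where wit: "similar_mat_wit A B P Q" using assms unfolding similar_mat_def by auto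
  have "similar_mat_wit (A ^\<^sub>m 2) (B ^\<^sub>m 2) P Q" by (rule similar_mat_wit_pow[OF wit])
  moreover obtain n where "A \<in> carrier_mat n n" "B \<in> carrier_mat n n"
    using similar_matD[OF assms] by auto
  ultimately show ?thesis unfolding similar_mat_def by (auto simp: numeral_2_eq_2)
qed

section \<open>Rayleigh quotients of real symmetric matrices\<close>

text \<open>The trace of the square is thus the squared Frobenius norm. This serves both to bound
  \<open>N *\<^sub>v x\<close> and, later, to evaluate the trace for an adjacency matrix.\<close>

lemma mat_trace_square_symmetric:
  fixes N :: "real mat"
  assumes N: "N \<in> carrier_mat n n" and sym: "transpose_mat N = N"
  shows "mat_trace (N * N) = (\<Sum>i<n. \<Sum>j<n. (N $$ (i, j))\<^sup>2)"
proof -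
  have "N $$ (j, i) = N $$ (i, j)" if "i < n" "j < n" for i j
    using N that sym by (metis carrier_matD index_transpose_mat(1))
  thus ?thesis
    using N unfolding mat_trace_def
    by (auto simp: index_mult_mat_sum[OF N N] power2_eq_square simp del: index_mult_mat(1) intro!: sum.cong)
qed

lemma scalar_prod_Cauchy_Schwarz:
  fixes x y :: "real vec"
  assumes "x \<in> carrier_vec n" "y \<in> carrier_vec n"
  shows "(x \<bullet> y)\<^sup>2 \<le> (x \<bullet> x) * (y \<bullet> y)"
proof -
  have "\<bar>x \<bullet> y\<bar> \<le> (\<Sum>i\<in>{0..<n}. \<bar>x $ i\<bar> * \<bar>y $ i\<bar>)"
    using assms by (simp add: scalar_prod_def abs_mult[symmetric] sum_abs)
  also have "\<dots> \<le> L2_set (\<lambda>i. x $ i) {0..<n} * L2_set (\<lambda>i. y $ i) {0..<n}"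
    by (rule L2_set_mult_ineq)
  also have "\<dots> = sqrt (x \<bullet> x) * sqrt (y \<bullet> y)"
    using assms by (simp add: L2_set_def scalar_prod_def power2_eq_square)
  finally have "\<bar>x \<bullet> y\<bar>\<^sup>2 \<le> (sqrt (x \<bullet> x) * sqrt (y \<bullet> y))\<^sup>2"
    by (intro power_mono) auto
  thus ?thesis
    by (simp add: power_mult_distrib scalar_prod_def sum_nonneg)
qed

text \<open>Symmetry moves one factor \<open>N\<close> across the scalar product, so that the
  Rayleigh numerator of a square becomes a squared norm.\<close>

lemma symmetric_form_square:
  fixes N :: "real mat"
  assumes N: "N \<in> carrier_mat n n" and sym: "transpose_mat N = N" and x: "x \<in> carrier_vec n"
  shows "x \<bullet> ((N * N) *\<^sub>v x) = (N *\<^sub>v x) \<bullet> (N *\<^sub>v x)"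
  using transpose_vec_mult_scalar[OF N, of "N *\<^sub>v x" x] N x sym
  by (simp add: assoc_mult_mat_vec[OF N N x])

text \<open>Cauchy--Schwarz is applied to each row of \<open>N\<close>; the squared norms of the
  rows add up to the squared Frobenius norm.\<close>

lemma mult_mat_vec_norm_le_trace:
  fixes N :: "real mat"
  assumes N: "N \<in> carrier_mat n n" and sym: "transpose_mat N = N" and x: "x \<in> carrier_vec n"
  shows "(N *\<^sub>v x) \<bullet> (N *\<^sub>v x) \<le> mat_trace (N * N) * (x \<bullet> x)"
proof -
  have "(N *\<^sub>v x) \<bullet> (N *\<^sub>v x) = (\<Sum>i<n. (row N i \<bullet> x)\<^sup>2)"
    using N x by (auto simp: scalar_prod_def[of "N *\<^sub>v x"] atLeast0LessThan power2_eq_square)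
  also have "\<dots> \<le> (\<Sum>i<n. (row N i \<bullet> row N i) * (x \<bullet> x))"
    by (intro sum_mono scalar_prod_Cauchy_Schwarz) (use N x in auto)
  also have "\<dots> = (\<Sum>i<n. row N i \<bullet> row N i) * (x \<bullet> x)"
    by (simp add: sum_distrib_right)
  also have "(\<Sum>i<n. row N i \<bullet> row N i) = mat_trace (N * N)"
    unfolding mat_trace_square_symmetric[OF N sym]
    using N by (auto simp: scalar_prod_def atLeast0LessThan power2_eq_square intro!: sum.cong)
  finally show ?thesis .
qed

text \<open>The power method: by Cauchy--Schwarz, iterated squaring of the matrix at least squares the
  Rayleigh quotient \<open>r\<close> each time, while the quotient of a square is at most its trace.  Hence
  \<open>r ^ 2 ^ k \<le> n * L ^ 2 ^ k\<close> for all \<open>k\<close>, which forces \<open>r \<le> L\<close>.\<close>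

lemma Rayleigh_nonneg_diag:
  fixes M B :: "real mat"
  assumes M: "M \<in> carrier_mat n n" and sym: "transpose_mat M = M"
    and sim: "similar_mat M B" and ut: "upper_triangular B"
    and diag: "\<And>i. i < n \<Longrightarrow> 0 \<le> B $$ (i, i) \<and> B $$ (i, i) \<le> L"
    and x: "x \<in> carrier_vec n" and s: "x \<bullet> x > 0"
  shows "x \<bullet> (M *\<^sub>v x) \<le> L * (x \<bullet> x)"
proof (rule ccontr)
  assume contra: "\<not> ?thesis"
  define s where "s = x \<bullet> x"
  \<comment> \<open>\<open>N k\<close> is \<open>M\<close> to the power \<open>2 ^ k\<close>, and
    \<open>C k\<close> is the same power of the triangular \<open>B\<close>. They stay similar, so
    the trace of \<open>N k\<close> can be read off the diagonal of \<open>C k\<close>.\<close>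
  define N where "N k = ((\<lambda>X. X * X) ^^ k) M" for k
  define C where "C k = ((\<lambda>X. X * X) ^^ k) B" for k
  define r where "r k = x \<bullet> (N k *\<^sub>v x) / s" for k
  have s0: "s > 0" using s by (simp add: s_def)
  have B: "B \<in> carrier_mat n n"
    using similar_matD[OF sim] M by (metis carrier_matD(1) carrier_matI insert_subset)
  have NS: "N (Suc k) = N k * N k" and CS: "C (Suc k) = C k * C k" for k
    by (simp_all add: N_def C_def)
  have N: "N k \<in> carrier_mat n n \<and> transpose_mat (N k) = N k" for k
  proof (induction k)
    case 0 show ?case using M sym by (simp add: N_def)
  next
    case (Suc k) thus ?case by (auto simp: NS transpose_mult[of _ n n _ n])
  qed
  have C: "C k \<in> carrier_mat n n \<and> upper_triangular (C k) \<and> similar_mat (N k) (C k)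
      \<and> (\<forall>i<n. C k $$ (i, i) = (B $$ (i, i)) ^ (2 ^ k))" for k
  proof (induction k)
    case 0 show ?case using B ut sim by (simp add: N_def C_def)
  next
    case (Suc k)
    thus ?case
      using upper_triangular_square[of "C k" n] similar_mat_square[of "N k" "C k"]
      by (auto simp: NS CS power_mult[symmetric] mult.commute simp del: index_mult_mat(1))
  qed
  have form: "x \<bullet> (N (Suc k) *\<^sub>v x) = (N k *\<^sub>v x) \<bullet> (N k *\<^sub>v x)" for k
    unfolding NS using N[of k] x by (intro symmetric_form_square) auto
  have r_step: "(r k)\<^sup>2 \<le> r (Suc k)" for k
  proof -
    have "(x \<bullet> (N k *\<^sub>v x))\<^sup>2 \<le> s * (x \<bullet> (N (Suc k) *\<^sub>v x))"
      using scalar_prod_Cauchy_Schwarz[of x n "N k *\<^sub>v x"] x N[of k]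
      by (auto simp: form s_def)
    thus ?thesis using s0
      by (simp add: r_def power2_eq_square field_simps)
  qed
  \<comment> \<open>Positivity of \<open>x \<bullet> x\<close> excludes dimension 0. Hence a
    diagonal entry exists, and it lies between 0 and \<open>L\<close>.\<close>
  have n0: "n > 0" using s x by (auto simp: scalar_prod_def intro!: gr0I)
  have L0: "L \<ge> 0" using diag[OF n0] by simp
  have r0: "r 0 > L" using contra s0 by (simp add: r_def N_def s_def field_simps)
  have r_pow: "(r 0) ^ (2 ^ k) \<le> r k" for k
  proof (induction k)
    case 0 show ?case by simp
  next
    case (Suc k)
    have "(r 0) ^ (2 ^ Suc k) = ((r 0) ^ (2 ^ k))\<^sup>2"
      by (simp add: power_mult[symmetric] mult.commute)
    also have "\<dots> \<le> (r k)\<^sup>2" using Suc r0 L0 by (intro power_mono) auto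
    also have "\<dots> \<le> r (Suc k)" by (rule r_step)
    finally show ?case .
  qed
  \<comment> \<open>The index is \<open>Suc k\<close> because the trace bound concerns the square of
    a symmetric matrix, here \<open>N k * N k\<close>.\<close>
  have r_le: "r (Suc k) \<le> real n * L ^ (2 ^ Suc k)" for k
  proof -
    have "r (Suc k) \<le> mat_trace (N (Suc k))"
      using mult_mat_vec_norm_le_trace[of "N k" n x] N[of k] x s0
      by (simp add: r_def form NS[symmetric] s_def field_simps)
    also have "\<dots> = mat_trace (C (Suc k))"
      using C[of "Suc k"] by (intro mat_trace_similar) auto
    also have "\<dots> = (\<Sum>i<n. (B $$ (i, i)) ^ (2 ^ Suc k))"
      using C[of "Suc k"] by (auto simp: mat_trace_def)
    also have "\<dots> \<le> (\<Sum>i<n. L ^ (2 ^ Suc k))"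
      by (intro sum_mono power_mono) (use diag in auto)
    finally show ?thesis by simp
  qed
  have key: "(r 0) ^ (2 ^ Suc k) \<le> real n * L ^ (2 ^ Suc k)" for k
    using r_pow[of "Suc k"] r_le[of k] by linarith
  show False
  \<comment> \<open>For \<open>L = 0\<close> the first squaring already contradicts
    \<open>r 0 > 0\<close>. Otherwise the powers of the ratio \<open>r 0 / L > 1\<close> outgrow the
    fixed factor \<open>n\<close>.\<close>
  proof (cases "L = 0")
    case True
    thus False using key[of 0] r0 by (simp add: power2_eq_square mult_le_0_iff)
  next
    case False
    hence L: "L > 0" using L0 by simp
    hence q: "r 0 / L > 1" using r0 by simp
    obtain m where m: "real n < (r 0 / L) ^ m" using real_arch_pow[OF q] by auto
    \<comment> \<open>\<open>key\<close> only speaks of exponents that are powers of two, so the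
      Archimedean exponent \<open>m\<close> is raised to one of these.\<close>
    have "m \<le> 2 ^ Suc m" using less_exp[of "Suc m"] by (metis Suc_leD less_imp_le)
    hence "real n < (r 0 / L) ^ (2 ^ Suc m)"
      using m q by (meson less_le_trans less_imp_le power_increasing)
    thus False using key[of m] L by (simp add: power_divide field_simps)
  qed
qed

section \<open>The spectrum of a real symmetric matrix\<close>

text \<open>The Hermitian argument: evaluating the form of \<open>?A\<close> at \<open>v\<close> and
  its conjugate from either side gives \<open>a\<close> and \<open>cnj a\<close> times the same
  nonzero number.\<close>

lemma symmetric_real_eigenvalue_Im:
  fixes A :: "real mat"
  assumes A: "A \<in> carrier_mat n n" and sym: "transpose_mat A = A"
    and ev: "eigenvalue (map_mat complex_of_real A) a"
  shows "Im a = 0"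
proof -
  let ?A = "map_mat complex_of_real A"
  have CA: "?A \<in> carrier_mat n n" using A by simp
  have symC: "transpose_mat ?A = ?A" using sym A
    by (metis map_mat_transpose)
  obtain v where v: "v \<in> carrier_vec n" "v \<noteq> 0\<^sub>v n" "?A *\<^sub>v v = a \<cdot>\<^sub>v v"
    using ev A unfolding eigenvalue_def eigenvector_def by auto
  have cv: "conjugate v \<in> carrier_vec n" using v by simp
  \<comment> \<open>The entries of \<open>?A\<close> are real, so multiplication by it commutes with
    conjugation.\<close>
  have cA: "?A *\<^sub>v conjugate v = conjugate (?A *\<^sub>v v)"
    using A v(1) by (intro eq_vecI) (auto simp: scalar_prod_def sum_conjugate conjugate_dist_mul)
  have "a * (v \<bullet>c v) = (?A *\<^sub>v v) \<bullet> conjugate v" using v by simp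
  also have "\<dots> = v \<bullet> (?A *\<^sub>v conjugate v)"
    using transpose_vec_mult_scalar[OF CA cv v(1)] symC by simp
  also have "\<dots> = v \<bullet> conjugate (a \<cdot>\<^sub>v v)" by (simp add: cA v(3))
  also have "\<dots> = cnj a * (v \<bullet>c v)" using v by (simp add: conjugate_smult_vec)
  finally have "a * (v \<bullet>c v) = cnj a * (v \<bullet>c v)" .
  hence "a = cnj a" using v by simp
  thus ?thesis by (metis add_cancel_right_right cnj.simps(2) equal_neg_zero)
qed

text \<open>Over the complex numbers the polynomial splits, and all its roots are real. The
  factorization then descends because the embedding of real polynomials is injective. It enables a
  real Schur decomposition.\<close>

lemma symmetric_real_char_poly_factorized:
  fixes A :: "real mat"
  assumes A: "A \<in> carrier_mat n n" and sym: "transpose_mat A = A"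
  obtains es where "char_poly A = (\<Prod>e\<leftarrow>es. [:- e, 1:])"
proof -
  let ?A = "map_mat complex_of_real A"
  have CA: "?A \<in> carrier_mat n n" using A by simp
  obtain as where as: "char_poly ?A = (\<Prod>a\<leftarrow>as. [:- a, 1:])"
    using char_poly_factorized[OF CA] by auto
  have re: "complex_of_real (Re a) = a" if "a \<in> set as" for a
  proof -
    have "poly (char_poly ?A) a = 0" using that
      by (auto simp: as poly_prod_list prod_list_zero_iff)
    hence "eigenvalue ?A a" by (simp add: eigenvalue_root_char_poly[OF CA])
    from symmetric_real_eigenvalue_Im[OF A sym this] show ?thesis by (simp add: complex_eq_iff)
  qed
  interpret h: map_poly_inj_comm_ring_hom complex_of_real ..
  have "map_poly complex_of_real (char_poly A) = (\<Prod>a\<leftarrow>as. [:- a, 1:])"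
    using as by (simp add: of_real_hom.char_poly_hom[OF A])
  also have "\<dots> = (\<Prod>a\<leftarrow>as. map_poly complex_of_real [:- Re a, 1:])"
    by (intro arg_cong[where f = prod_list] map_cong refl) (simp add: re)
  also have "\<dots> = map_poly complex_of_real (\<Prod>e\<leftarrow>map Re as. [:- e, 1:])"
    by (simp add: h.hom_prod_list o_def)
  finally have "char_poly A = (\<Prod>e\<leftarrow>map Re as. [:- e, 1:])"
    by (simp only: h.eq_iff)
  thus ?thesis by (rule that)
qed

lemma proots_linear_factors: "proots (\<Prod>e\<leftarrow>es. [:- e, 1:]) = mset (es :: 'a :: idom list)"
proof (induction es)
  case (Cons e es)
  have "(\<Prod>e\<leftarrow>es. [:- e, 1:]) \<noteq> 0" by (auto simp: prod_list_zero_iff)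
  thus ?case using Cons by (simp add: proots_mult del: mult_pCons_left)
qed simp

text \<open>A Schur form \<open>B\<close> carries the eigenvalues on its diagonal, so the first
  claim compares traces of squares. In the second, the witness is the largest eigenvalue; a shift by
  a multiple of the identity reduces it to a nonnegative diagonal.\<close>

lemma symmetric_real_spectrum:
  fixes A :: "real mat"
  assumes A: "A \<in> carrier_mat n n" and sym: "transpose_mat A = A"
  defines "E \<equiv> proots (char_poly A)"
  shows "(\<Sum>e\<in>#E. e\<^sup>2) = mat_trace (A * A)"
    and "\<And>x. x \<in> carrier_vec n \<Longrightarrow> x \<bullet> x > 0 \<Longrightarrow> \<exists>e\<in>#E. x \<bullet> (A *\<^sub>v x) \<le> e * (x \<bullet> x)"
proof -
  obtain es where es: "char_poly A = (\<Prod>e\<leftarrow>es. [:- e, 1:])"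
    by (rule symmetric_real_char_poly_factorized[OF A sym])
  obtain B where B: "B \<in> carrier_mat n n" and ut: "upper_triangular B" and sim: "similar_mat A B"
    using schur_decomposition_exists[OF A es] by auto
  have "E = mset (diag_mat B)"
    unfolding E_def char_poly_similar[OF sim] char_poly_upper_triangular[OF B ut]
    by (rule proots_linear_factors)
  hence E: "E = image_mset (\<lambda>i. B $$ (i, i)) (mset_set {..<n})"
    using B by (simp add: diag_mat_def atLeast0LessThan[symmetric])
  have "(\<Sum>e\<in>#E. e\<^sup>2) = (\<Sum>i<n. (B $$ (i, i))\<^sup>2)"
    by (simp add: E image_mset.compositionality o_def sum_unfold_sum_mset)
  also have "\<dots> = mat_trace (B * B)"
    using B upper_triangular_square(2)[OF B ut]
    by (simp add: mat_trace_def del: index_mult_mat(1))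
  also have "\<dots> = mat_trace (A * A)"
    by (rule mat_trace_similar[OF similar_mat_square[OF sim], symmetric])
  finally show "(\<Sum>e\<in>#E. e\<^sup>2) = mat_trace (A * A)" .
  fix x :: "real vec" assume x: "x \<in> carrier_vec n" and s: "x \<bullet> x > 0"
  have n0: "n > 0" using s x by (auto simp: scalar_prod_def intro!: gr0I)
  let ?D = "(\<lambda>i. B $$ (i, i)) ` {..<n}"
  define L where "L = Max ?D"
  \<comment> \<open>Adding \<open>c\<close> times the identity moves the least diagonal entry to 0.
    Since \<open>char_matrix\<close> subtracts its argument, the shifted matrices appear with
    \<open>- c\<close>.\<close>
  define c where "c = - Min ?D"
  have fin: "finite ?D" "?D \<noteq> {}" using n0 by auto
  have LE: "L \<in># E" using Max_in[OF fin] by (simp add: E L_def)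
  have diag: "0 \<le> char_matrix B (- c) $$ (i, i) \<and> char_matrix B (- c) $$ (i, i) \<le> L + c" if "i < n" for i
  proof -
    have "Min ?D \<le> B $$ (i, i)" "B $$ (i, i) \<le> L"
      using that fin unfolding L_def by (auto intro!: Min_le Max_ge)
    thus ?thesis using that B by (simp add: char_matrix_def c_def)
  qed
  have form: "x \<bullet> (char_matrix A (- c) *\<^sub>v x) = x \<bullet> (A *\<^sub>v x) + c * (x \<bullet> x)"
  proof -
    have "char_matrix A (- c) *\<^sub>v x = A *\<^sub>v x + c \<cdot>\<^sub>v x"
      using A x unfolding char_matrix_def
      by (auto simp: add_mult_distrib_mat_vec[of _ n n])
    thus ?thesis using A x by (simp add: scalar_prod_add_distrib[of _ n])
  qed
  have "x \<bullet> (char_matrix A (- c) *\<^sub>v x) \<le> (L + c) * (x \<bullet> x)"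
  proof (rule Rayleigh_nonneg_diag[of _ n "char_matrix B (- c)"])
    show "char_matrix A (- c) \<in> carrier_mat n n" using A by simp
    show "transpose_mat (char_matrix A (- c)) = char_matrix A (- c)"
      using A sym by (auto simp: char_matrix_def transpose_add[of _ n n])
    show "similar_mat (char_matrix A (- c)) (char_matrix B (- c))"
      using sim similar_mat_wit_char_matrix unfolding similar_mat_def by blast
    show "upper_triangular (char_matrix B (- c))"
      using ut B unfolding upper_triangular_def char_matrix_def by auto
  qed (use diag x s in auto)
  \<comment> \<open>The shift contributes \<open>c * (x \<bullet> x)\<close> to both sides and
    cancels.\<close>
  hence "x \<bullet> (A *\<^sub>v x) \<le> L * (x \<bullet> x)" unfolding form by (simp add: algebra_simps)
  with LE show "\<exists>e\<in>#E. x \<bullet> (A *\<^sub>v x) \<le> e * (x \<bullet> x)" by blast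
qed

section \<open>Adjacency matrices of a graph and its complement\<close>

lemma adjacency_matrix_symmetric:
  assumes "pair_graph G"
  shows "transpose_mat (adjacency_matrix G) = adjacency_matrix G"
proof -
  interpret pair_graph G by fact
  have "(u, v) \<in> parcs G \<longleftrightarrow> (v, u) \<in> parcs G" for u v
    using pair_sym_arcs by (auto simp: symmetric_def arcs_ends_conv dest: symD)
  thus ?thesis by (auto simp: adjacency_matrix_def)
qed

text \<open>For a graph this is the number of arcs, that is, twice the number of edges.\<close>

definition adjacency_sum :: "'a pair_pre_digraph \<Rightarrow> real" where
  "adjacency_sum G =
     (\<Sum>i<card (pverts G). \<Sum>j<card (pverts G). adjacency_matrix G $$ (i, j))"

lemma adjacency_sum_nonneg: "adjacency_sum G \<ge> 0"
  unfolding adjacency_sum_def by (intro sum_nonneg) (auto simp: adjacency_matrix_def)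

lemma sum_mset_power2_nonneg: "(\<Sum>x\<in>#M. x\<^sup>2) \<ge> (0 :: 'a :: linordered_idom)"
  by (induction M) auto

lemma s_plus_bounds:
  assumes G: "pair_graph G" and n: "card (pverts G) > 0"
  shows "s_plus G \<le> adjacency_sum G"
    and "(adjacency_sum G / real (card (pverts G)))\<^sup>2 \<le> s_plus G"
proof -
  define n where "n = card (pverts G)"
  let ?A = "adjacency_matrix G"
  let ?E = "graph_eigenvalues G"
  have A: "?A \<in> carrier_mat n n" by (simp add: adjacency_matrix_def n_def)
  note sym = adjacency_matrix_symmetric[OF G]
  note spec = symmetric_real_spectrum[OF A sym, folded graph_eigenvalues_def]
  have "s_plus G \<le> s_plus G + (\<Sum>e\<in>#filter_mset (\<lambda>e. \<not> e > 0) ?E. e\<^sup>2)"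
    by (simp add: sum_mset_power2_nonneg)
  also have "\<dots> = (\<Sum>e\<in>#?E. e\<^sup>2)"
    unfolding s_plus_def
    by (metis image_mset_union multiset_partition sum_mset.union)
  also have "\<dots> = adjacency_sum G"
    unfolding spec(1) mat_trace_square_symmetric[OF A sym] adjacency_sum_def n_def[symmetric]
    \<comment> \<open>Entries 0 and 1 equal their own squares.\<close>
    by (intro sum.cong refl) (auto simp: adjacency_matrix_def n_def)
  finally show "s_plus G \<le> adjacency_sum G" .

  let ?x = "vec n (\<lambda>_. 1 :: real)"
  have xx: "?x \<bullet> ?x = real n" by (simp add: scalar_prod_def)
  have xA: "?x \<bullet> (?A *\<^sub>v ?x) = adjacency_sum G"
    using A by (simp add: scalar_prod_def adjacency_sum_def n_def[symmetric] atLeast0LessThan)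
  obtain e where e: "e \<in># ?E" "adjacency_sum G \<le> e * real n"
    using spec(2)[of ?x] n unfolding xx xA n_def[symmetric] by auto
  have le: "adjacency_sum G / real n \<le> e" using e(2) n by (simp add: n_def field_simps)
  have sp: "s_plus G \<ge> 0" unfolding s_plus_def by (simp add: sum_mset_power2_nonneg)
  have "(adjacency_sum G / real n)\<^sup>2 \<le> e\<^sup>2"
    using le adjacency_sum_nonneg[of G] by (intro power_mono) auto
  also have "e\<^sup>2 \<le> s_plus G"
  \<comment> \<open>A positive \<open>e\<close> is one of the eigenvalues counted by
    \<open>s_plus\<close>. Otherwise \<open>e = 0\<close>, as it is at least the nonnegative average
    degree.\<close>
  proof (cases "e > 0")
    case True
    hence "e \<in># filter_mset (\<lambda>e. e > 0) ?E" using e by simp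
    then obtain F where F: "filter_mset (\<lambda>e. e > 0) ?E = add_mset e F"
      by (auto dest: multi_member_split)
    have "s_plus G = e\<^sup>2 + (\<Sum>e\<in>#F. e\<^sup>2)" unfolding s_plus_def F by simp
    moreover have "(\<Sum>e\<in>#F. e\<^sup>2) \<ge> 0" by (simp add: sum_mset_power2_nonneg)
    ultimately show ?thesis by simp
  next
    case False
    moreover have "e \<ge> 0" using le adjacency_sum_nonneg[of G]
      by (meson divide_nonneg_nonneg of_nat_0_le_iff order_trans)
    ultimately show ?thesis using sp by simp
  qed
  finally show "(adjacency_sum G / real (card (pverts G)))\<^sup>2 \<le> s_plus G" by (simp add: n_def)
qed

text \<open>Each off-diagonal position holds a 1 in exactly one of the two matrices, and the
  diagonals vanish.\<close>

lemma adjacency_sum_complement: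
  assumes G: "pair_graph G"
  shows "adjacency_sum G + adjacency_sum (graph_complement G)
       = real (card (pverts G)) * (real (card (pverts G)) - 1)"
proof -
  interpret pair_graph G by fact
  define n where "n = card (pverts G)"
  let ?H = "graph_complement G"
  have pv: "pverts ?H = pverts G" by (simp add: graph_complement_def)
  have pa: "parcs ?H = {(u, v). u \<in> pverts G \<and> v \<in> pverts G \<and> u \<noteq> v \<and> (u, v) \<notin> parcs G}"
    by (simp add: graph_complement_def)
  \<comment> \<open>The chosen enumeration depends only on the vertex set, so both matrices use the
    same indexing and can be compared entry by entry.\<close>
  have vl: "vertex_list ?H = vertex_list G" by (simp add: vertex_list_def pv)
  note v = vertex_list[OF pair_finite_verts]
  have "adjacency_matrix G $$ (i, j) + adjacency_matrix ?H $$ (i, j) = (if j = i then 0 else 1)"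
    if "i < n" "j < n" for i j
  proof -
    have "vertex_list G ! i \<in> pverts G" "vertex_list G ! j \<in> pverts G"
      using that v n_def by (metis nth_mem)+
    moreover have "vertex_list G ! i = vertex_list G ! j \<longleftrightarrow> i = j"
      using that v by (simp add: nth_eq_iff_index_eq n_def)
    moreover have "(u, u) \<notin> parcs G" for u using no_loops' by blast
    ultimately show ?thesis
      using that by (auto simp: adjacency_matrix_def pv vl n_def pa)
  qed
  hence "adjacency_sum G + adjacency_sum ?H = (\<Sum>i<n. \<Sum>j<n. if j = i then 0 else 1)"
    unfolding adjacency_sum_def pv n_def[symmetric] sum.distrib[symmetric]
    by (intro sum.cong refl) auto
  also have "\<dots> = (\<Sum>i<n. real n - 1)"
  proof (intro sum.cong refl)
    fix i assume "i \<in> {..<n}"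
    hence "(\<Sum>j<n. if j = i then 0 else 1 :: real) = (\<Sum>j\<in>{..<n} - {i}. 1)"
      by (subst sum.remove[of _ i]) auto
    thus "(\<Sum>j<n. if j = i then 0 else 1 :: real) = real n - 1"
      using \<open>i \<in> {..<n}\<close> by (simp add: of_nat_diff)
  qed
  also have "\<dots> = real n * (real n - 1)" by simp
  finally show ?thesis by (simp add: n_def)
qed

theorem theorem1:
  fixes G :: "'a pair_pre_digraph" and n :: nat
  assumes "pair_graph G"
    and "n = card (pverts G)"
    and "n \<ge> 1"
  shows "real n - 1 \<le> sqrt (s_plus G) + sqrt (s_plus (graph_complement G))
       \<and> sqrt (s_plus G) + sqrt (s_plus (graph_complement G)) < sqrt 2 * real n"
proof
  let ?H = "graph_complement G"
  have pv: "card (pverts ?H) = n" using assms(2) by (simp add: graph_complement_def)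
  have H: "pair_graph ?H" by (rule pair_graph_complement[OF assms(1)])
  have n: "real n \<ge> 1" using assms(3) by simp
  have G_bounds: "s_plus G \<le> adjacency_sum G" "(adjacency_sum G / n)\<^sup>2 \<le> s_plus G"
    using s_plus_bounds[OF assms(1)] assms by auto
  have H_bounds: "s_plus ?H \<le> adjacency_sum ?H" "(adjacency_sum ?H / n)\<^sup>2 \<le> s_plus ?H"
    using s_plus_bounds[OF H] assms(3) by (auto simp: pv)
  have total: "adjacency_sum G + adjacency_sum ?H = real n * (real n - 1)"
    using adjacency_sum_complement[OF assms(1)] assms(2) by simp
  have "real n - 1 = adjacency_sum G / n + adjacency_sum ?H / n"
    using total n by (simp add: field_simps)
  also have "\<dots> \<le> sqrt (s_plus G) + sqrt (s_plus ?H)"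
    by (intro add_mono real_le_rsqrt G_bounds H_bounds)
  finally show "real n - 1 \<le> sqrt (s_plus G) + sqrt (s_plus ?H)" .

  define a b where "a = sqrt (s_plus G)" and "b = sqrt (s_plus ?H)"
  \<comment> \<open>Nonnegativity makes the squares of \<open>a\<close> and \<open>b\<close> equal
    to the two \<open>s_plus\<close> values.\<close>
  have nonneg: "s_plus G \<ge> 0" "s_plus ?H \<ge> 0"
    using G_bounds(2) H_bounds(2) by (meson order_trans zero_le_power2)+
  have "(a + b)\<^sup>2 \<le> 2 * (a\<^sup>2 + b\<^sup>2)"
    using zero_le_power2[of "a - b"] by (simp add: power2_eq_square algebra_simps)
  also have "a\<^sup>2 + b\<^sup>2 \<le> real n * (real n - 1)"
    using G_bounds(1) H_bounds(1) total nonneg by (simp add: a_def b_def)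
  \<comment> \<open>Strictness arises here, from \<open>n - 1 < n\<close> and
    \<open>n > 0\<close>.\<close>
  also have "2 * (real n * (real n - 1)) < (sqrt 2 * real n)\<^sup>2"
    using n by (simp add: power_mult_distrib power2_eq_square algebra_simps)
  finally have "(a + b)\<^sup>2 < (sqrt 2 * real n)\<^sup>2" by simp
  thus "sqrt (s_plus G) + sqrt (s_plus ?H) < sqrt 2 * real n"
    using power2_less_imp_less[of "a + b"] by (simp add: a_def b_def)
qed

end
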